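(* Let $\alpha>0$. There exist a Hilbert space $H$, a dictionary $\mathbb{D}\subset H$ with $\|g\|_H\le 1$ for all $g\in\mathbb{D}$, and constants $C<\infty$ and $K>0$ such that $$\epsilon_n(B_1(\mathbb{D}))_H\le Cn^{-\frac12-\alpha}\qquad\text{for all } n\ge1,$$ and for each $n\ge 1$ $$\sup_{f\in B_1(\mathbb{D})}\|f-f_n\|_H\ge Kn^{-\frac12-\alpha},$$ where $f_n$ is the $n$-th iterate of the orthogonal greedy algorithm with dictionary $\mathbb{D}$ applied to $f$.
   Context: Hilbert spaces are real. A dictionary is a subset $\mathbb{D}\subset H$. The (closed, symmetric) convex hull of $\mathbb{D}$ is $$B_1(\mathbb{D}) = \overline{\left\{\sum_{j=1}^n a_jh_j:~n\in\mathbb{N},~h_j\in\mathbb{D},~a_j\in\mathbb{R},~\sum_{j=1}^n|a_j|\le 1\right\}},$$ with closure in $H$. The (dyadic) metric entropy of $A\subset H$ is $\epsilon_n(A)_H=\inf\{\epsilon: A \text{ can be covered by } 2^n \text{ balls of radius } \epsilon \text{ in } H\}$. The orthogonal greedy algorithm applied to $f\in H$ with dictionary $\mathbb{D}$ generates iterates $f_k$ by $f_0=0$ and, for $k\ge1$, $$g_k\in\arg\max_{g\in\mathbb{D}}|\langle g,r_{k-1}\rangle|,\qquad f_k=P_kf,$$ where $r_{k}=f-f_{k}$ is the residual and $P_k$ is the orthogonal projection onto $\mathrm{span}(g_1,\dots,g_k)$. The assertion includes that the maxima are attained, so that the iterates exist; the lower bound holds whichever maximizers $g_k$ are selected. *)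

theory Defs
  imports "HOL-Analysis.Analysis"
begin

section \<open>The real Hilbert space of square-summable sequences\<close>

text \<open>
  Since one cannot quantify existentially over types, Hilbert spaces are taken to be closed
  subspaces of \<open>ell2\<close>. Up to isometry these are exactly the separable real Hilbert spaces.
\<close>

typedef ell2 = "{x :: nat \<Rightarrow> real. summable (\<lambda>i. (x i)\<^sup>2)}"
  morphisms coord Abs_ell2
  by (rule exI[of _ "\<lambda>_. 0"]) simp

setup_lifting type_definition_ell2

lemma summable_coord_sq: "summable (\<lambda>i. (coord x i)\<^sup>2)"
  using coord[of x] by simp

lemma summable_sq_add:
  fixes x y :: "nat \<Rightarrow> real"
  assumes "summable (\<lambda>i. (x i)\<^sup>2)" "summable (\<lambda>i. (y i)\<^sup>2)"
  shows "summable (\<lambda>i. (x i + y i)\<^sup>2)"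
proof (rule summable_comparison_test'[where N = 0])
  show "summable (\<lambda>i. 2 * (x i)\<^sup>2 + 2 * (y i)\<^sup>2)"
    by (intro summable_add summable_mult assms)
  show "norm ((x n + y n)\<^sup>2) \<le> 2 * (x n)\<^sup>2 + 2 * (y n)\<^sup>2" for n
    using sum_squares_bound[of "x n" "y n"]
    unfolding real_norm_def abs_power2 by (simp add: power2_sum)
qed

lemma summable_sq_mult:
  fixes x y :: "nat \<Rightarrow> real"
  assumes "summable (\<lambda>i. (x i)\<^sup>2)" "summable (\<lambda>i. (y i)\<^sup>2)"
  shows "summable (\<lambda>i. x i * y i)"
proof (rule summable_comparison_test'[where N = 0])
  show "summable (\<lambda>i. (x i)\<^sup>2 + (y i)\<^sup>2)"
    by (intro summable_add assms)
  show "norm (x n * y n) \<le> (x n)\<^sup>2 + (y n)\<^sup>2" for n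
    using sum_squares_bound[of "\<bar>x n\<bar>" "\<bar>y n\<bar>"] mult_nonneg_nonneg[of "\<bar>x n\<bar>" "\<bar>y n\<bar>"]
    unfolding real_norm_def abs_mult power2_abs by linarith
qed

lemma summable_coord_mult: "summable (\<lambda>i. coord x i * coord y i)"
  by (intro summable_sq_mult summable_coord_sq)

instantiation ell2 :: real_inner
begin

lift_definition zero_ell2 :: ell2 is "\<lambda>_. 0" by simp

lift_definition plus_ell2 :: "ell2 \<Rightarrow> ell2 \<Rightarrow> ell2" is "\<lambda>x y i. x i + y i"
  by (rule summable_sq_add)

lift_definition uminus_ell2 :: "ell2 \<Rightarrow> ell2" is "\<lambda>x i. - x i" by simp

lift_definition minus_ell2 :: "ell2 \<Rightarrow> ell2 \<Rightarrow> ell2" is "\<lambda>x y i. x i - y i"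
proof -
  fix x y :: "nat \<Rightarrow> real"
  assume "summable (\<lambda>i. (x i)\<^sup>2)" "summable (\<lambda>i. (y i)\<^sup>2)"
  then show "summable (\<lambda>i. (x i - y i)\<^sup>2)"
    using summable_sq_add[of x "\<lambda>i. - y i"] by simp
qed

lift_definition scaleR_ell2 :: "real \<Rightarrow> ell2 \<Rightarrow> ell2" is "\<lambda>c x i. c * x i"
  by (simp add: power_mult_distrib summable_mult)

lift_definition inner_ell2 :: "ell2 \<Rightarrow> ell2 \<Rightarrow> real" is "\<lambda>x y. \<Sum>i. x i * y i" .

definition norm_ell2 :: "ell2 \<Rightarrow> real" where "norm_ell2 x = sqrt (inner x x)"

definition dist_ell2 :: "ell2 \<Rightarrow> ell2 \<Rightarrow> real" where "dist_ell2 x y = norm (x - y)"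

definition sgn_ell2 :: "ell2 \<Rightarrow> ell2" where "sgn_ell2 x = inverse (norm x) *\<^sub>R x"

definition uniformity_ell2 :: "(ell2 \<times> ell2) filter" where
  "uniformity_ell2 = (INF e\<in>{0<..}. principal {(x, y). dist x y < e})"

definition open_ell2 :: "ell2 set \<Rightarrow> bool" where
  "open_ell2 U = (\<forall>x\<in>U. eventually (\<lambda>(x', y). x' = x \<longrightarrow> y \<in> U) uniformity)"

instance
proof
  fix x y z :: ell2 and a b :: real
  show "x + y + z = x + (y + z)" by transfer (simp add: add.assoc)
  show "x + y = y + x" by transfer (simp add: add.commute)
  show "0 + x = x" by transfer simp
  show "- x + x = 0" by transfer simp
  show "x - y = x + - y" by transfer simp
  show "a *\<^sub>R (x + y) = a *\<^sub>R x + a *\<^sub>R y" by transfer (simp add: algebra_simps)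
  show "(a + b) *\<^sub>R x = a *\<^sub>R x + b *\<^sub>R x" by transfer (simp add: algebra_simps)
  show "a *\<^sub>R b *\<^sub>R x = (a * b) *\<^sub>R x" by transfer (simp add: algebra_simps)
  show "1 *\<^sub>R x = x" by transfer simp
  show "dist x y = norm (x - y)" by (rule dist_ell2_def)
  show "sgn x = inverse (norm x) *\<^sub>R x" by (rule sgn_ell2_def)
  show "uniformity = (INF e\<in>{0<..}. principal {(x :: ell2, y). dist x y < e})"
    by (rule uniformity_ell2_def)
  show "open U = (\<forall>x\<in>U. \<forall>\<^sub>F (x', y) in uniformity. x' = x \<longrightarrow> y \<in> U)" for U :: "ell2 set"
    by (rule open_ell2_def)
  show "inner x y = inner y x" by transfer (simp add: mult.commute)
  show "inner (x + y) z = inner x z + inner y z"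
    by transfer (simp add: distrib_right suminf_add summable_sq_mult)
  show "inner (a *\<^sub>R x) y = a * inner x y"
    by transfer (simp add: mult.assoc suminf_mult summable_sq_mult)
  show "0 \<le> inner x x"
    by transfer (simp add: suminf_nonneg flip: power2_eq_square)
  show "inner x x = 0 \<longleftrightarrow> x = 0"
    by transfer (auto simp: suminf_eq_zero_iff fun_eq_iff simp flip: power2_eq_square)
  show "norm x = sqrt (inner x x)" by (rule norm_ell2_def)
qed

end

lemma coord_minus: "coord (x - y) i = coord x i - coord y i"
  by transfer simp

lemma norm_ell2_sq: "(norm x)\<^sup>2 = (\<Sum>i. (coord x i)\<^sup>2)"
  unfolding power2_norm_eq_inner by transfer (simp add: power2_eq_square)

lemma sum_coord_sq_le: "(\<Sum>i<n. (coord x i)\<^sup>2) \<le> (norm x)\<^sup>2"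
  unfolding norm_ell2_sq by (intro sum_le_suminf summable_coord_sq) auto

lemma abs_coord_le_norm: "\<bar>coord x i\<bar> \<le> norm x"
proof -
  have "(coord x i)\<^sup>2 \<le> (\<Sum>j<Suc i. (coord x j)\<^sup>2)"
    by (simp add: sum_nonneg)
  also have "\<dots> \<le> (norm x)\<^sup>2" by (rule sum_coord_sq_le)
  finally show ?thesis by (simp add: abs_le_square_iff[symmetric])
qed

instance ell2 :: complete_space
proof
  fix X :: "nat \<Rightarrow> ell2"
  assume X: "Cauchy X"
  have "Cauchy (\<lambda>n. coord (X n) i)" for i
  proof (rule metric_CauchyI)
    fix e :: real assume "0 < e"
    then obtain M where M: "\<forall>m\<ge>M. \<forall>n\<ge>M. dist (X m) (X n) < e"
      using metric_CauchyD[OF X] by blast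
    have "dist (coord (X m) i) (coord (X n) i) < e" if "m \<ge> M" "n \<ge> M" for m n
    proof -
      have "dist (coord (X m) i) (coord (X n) i) \<le> dist (X m) (X n)"
        using abs_coord_le_norm[of "X m - X n" i] by (simp add: dist_norm coord_minus)
      with M that show ?thesis by (meson le_less_trans)
    qed
    then show "\<exists>M. \<forall>m\<ge>M. \<forall>n\<ge>M. dist (coord (X m) i) (coord (X n) i) < e" by blast
  qed
  then have "\<forall>i. \<exists>l. (\<lambda>n. coord (X n) i) \<longlonglongrightarrow> l"
    by (simp add: Cauchy_convergent_iff convergent_def)
  then obtain L where L: "\<And>i. (\<lambda>n. coord (X n) i) \<longlonglongrightarrow> L i" by metis
  have tail: "\<exists>M. \<forall>m\<ge>M. \<forall>k. (\<Sum>i<k. (coord (X m) i - L i)\<^sup>2) \<le> e\<^sup>2" if "e > 0" for e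
  proof -
    obtain M where M: "\<forall>m\<ge>M. \<forall>n\<ge>M. dist (X m) (X n) < e"
      using metric_CauchyD[OF X \<open>e > 0\<close>] by blast
    have "(\<Sum>i<k. (coord (X m) i - L i)\<^sup>2) \<le> e\<^sup>2" if "m \<ge> M" for m k
    proof (rule LIMSEQ_le_const2)
      show "(\<lambda>n. \<Sum>i<k. (coord (X m) i - coord (X n) i)\<^sup>2)
          \<longlonglongrightarrow> (\<Sum>i<k. (coord (X m) i - L i)\<^sup>2)"
        by (intro tendsto_intros L)
      have "(\<Sum>i<k. (coord (X m) i - coord (X n) i)\<^sup>2) \<le> e\<^sup>2" if "n \<ge> M" for n
      proof -
        have "(\<Sum>i<k. (coord (X m) i - coord (X n) i)\<^sup>2) \<le> (norm (X m - X n))\<^sup>2"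
          using sum_coord_sq_le[of "X m - X n" k] by (simp add: coord_minus)
        also have "\<dots> \<le> e\<^sup>2"
          using M that \<open>m \<ge> M\<close> by (intro power_mono) (auto simp: dist_norm less_imp_le)
        finally show ?thesis .
      qed
      then show "\<exists>N. \<forall>n\<ge>N. (\<Sum>i<k. (coord (X m) i - coord (X n) i)\<^sup>2) \<le> e\<^sup>2" by blast
    qed
    then show ?thesis by blast
  qed
  have sm: "summable (\<lambda>i. (coord (X m) i - L i)\<^sup>2)"
    if "\<forall>k. (\<Sum>i<k. (coord (X m) i - L i)\<^sup>2) \<le> e\<^sup>2" for m and e :: real
    using that by (intro summableI_nonneg_bounded[where x = "e\<^sup>2"]) auto
  obtain M1 where M1: "\<forall>m\<ge>M1. \<forall>k. (\<Sum>i<k. (coord (X m) i - L i)\<^sup>2) \<le> 1\<^sup>2"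
    using tail[of 1] by auto
  have "summable (\<lambda>i. (coord (X M1) i + - (coord (X M1) i - L i))\<^sup>2)"
    using sm[of M1 1] M1
    by (intro summable_sq_add summable_coord_sq) (simp add: power2_commute)
  then have sL: "summable (\<lambda>i. (L i)\<^sup>2)" by simp
  define l where "l = Abs_ell2 L"
  have l: "coord l i = L i" for i
    using sL by (simp add: l_def Abs_ell2_inverse)
  have "X \<longlonglongrightarrow> l"
  proof (rule metric_LIMSEQ_I)
    fix e :: real assume "0 < e"
    then obtain M where M: "\<forall>m\<ge>M. \<forall>k. (\<Sum>i<k. (coord (X m) i - L i)\<^sup>2) \<le> (e/2)\<^sup>2"
      using tail[of "e/2"] by auto
    have "dist (X m) l < e" if "m \<ge> M" for m
    proof -
      have "(norm (X m - l))\<^sup>2 \<le> (e/2)\<^sup>2"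
        unfolding norm_ell2_sq coord_minus l
        using M that by (intro suminf_le_const sm[of m "e/2"]) auto
      then have "norm (X m - l) \<le> e/2"
        by (rule power2_le_imp_le) (use \<open>0 < e\<close> in simp)
      with \<open>0 < e\<close> show ?thesis by (simp add: dist_norm)
    qed
    then show "\<exists>M. \<forall>m\<ge>M. dist (X m) l < e" by blast
  qed
  then show "convergent X" by (auto simp: convergent_def)
qed


section \<open>Convex hull of a dictionary and metric entropy\<close>

definition B1 :: "'a::real_inner set \<Rightarrow> 'a set" where
  "B1 D = closure {\<Sum>j=1..n. a j *\<^sub>R h j | (n::nat) (a :: nat \<Rightarrow> real) h.
     (\<forall>j\<in>{1..n}. h j \<in> D) \<and> (\<Sum>j=1..n. \<bar>a j\<bar>) \<le> 1}"

text \<open>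
  The infimum is taken in \<open>ereal\<close>, so that it is \<open>\<infinity>\<close> when no cover exists. The centres lie in
  the ambient space \<open>H\<close> and may repeat.
\<close>

definition entropy_number :: "'a::real_inner set \<Rightarrow> nat \<Rightarrow> 'a set \<Rightarrow> ereal" where
  "entropy_number H n A =
     Inf {ereal e | e. e \<ge> 0 \<and>
       (\<exists>c. (\<forall>i < (2::nat)^n. c i \<in> H) \<and> A \<subseteq> (\<Union>i < (2::nat)^n. cball (c i) e))}"


section \<open>The orthogonal greedy algorithm\<close>

definition orth_proj :: "'a::real_inner set \<Rightarrow> 'a \<Rightarrow> 'a" where
  "orth_proj S x = (THE p. p \<in> S \<and> (\<forall>y\<in>S. orthogonal (x - p) y))"

lemma orth_proj_unique:
  fixes S :: "'a::real_inner set"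
  assumes "subspace S" "p \<in> S" "\<forall>y\<in>S. orthogonal (x - p) y"
    "q \<in> S" "\<forall>y\<in>S. orthogonal (x - q) y"
  shows "p = q"
proof -
  have "p - q \<in> S" using assms by (simp add: subspace_diff)
  then have "inner (x - q) (p - q) - inner (x - p) (p - q) = 0"
    using assms by (simp add: orthogonal_def)
  then have "inner (p - q) (p - q) = 0"
    by (simp flip: inner_diff_left)
  then show ?thesis by simp
qed

lemma orth_proj_eqI:
  fixes S :: "'a::real_inner set"
  assumes "subspace S" "p \<in> S" "\<And>y. y \<in> S \<Longrightarrow> orthogonal (x - p) y"
  shows "orth_proj S x = p"
  unfolding orth_proj_def using assms orth_proj_unique[of S]
  by (intro the_equality) blast+

lemma orth_decomp_exists_span:
  fixes T :: "'a::real_inner set"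
  assumes "finite T"
  shows "\<exists>p\<in>span T. \<forall>y\<in>span T. orthogonal (x - p) y"
  using assms
proof (induction T arbitrary: x)
  case empty
  then show ?case by (simp add: orthogonal_def)
next
  case (insert t T)
  obtain p where p: "p \<in> span T" "\<forall>y\<in>span T. orthogonal (x - p) y"
    using insert.IH by blast
  obtain q where q: "q \<in> span T" "\<forall>y\<in>span T. orthogonal (t - q) y"
    using insert.IH by blast
  define u where "u = t - q"
  define c where "c = inner x u / inner u u"
  define w where "w = p + c *\<^sub>R u"
  have Tsub: "span T \<subseteq> span (insert t T)"
    by (intro span_mono) auto
  have uin: "u \<in> span (insert t T)"
    unfolding u_def using q(1) Tsub by (intro span_diff) (auto intro: span_base)
  have win: "w \<in> span (insert t T)"
    unfolding w_def using p(1) Tsub uin by (intro span_add span_scale) auto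
  have uy: "inner u y = 0" if "y \<in> span T" for y
    using q(2) that by (simp add: u_def orthogonal_def)
  have wT: "inner (x - w) y = 0" if "y \<in> span T" for y
    using p(2) that uy[OF that]
    by (simp add: w_def orthogonal_def inner_diff_left inner_add_left)
  have "inner p u = 0" using uy[OF p(1)] by (simp add: inner_commute)
  then have wu: "inner (x - w) u = 0"
    by (cases "u = 0") (simp_all add: w_def c_def inner_diff_left inner_add_left)
  have "inner (x - w) y = 0" if y: "y \<in> span (insert t T)" for y
  proof -
    from y obtain k where k: "y - k *\<^sub>R t \<in> span T"
      by (auto simp: span_insert)
    then have k': "(y - k *\<^sub>R t) + k *\<^sub>R q \<in> span T"
      using q(1) by (intro span_add span_scale)
    have eq: "y = ((y - k *\<^sub>R t) + k *\<^sub>R q) + k *\<^sub>R u"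
      by (simp add: u_def algebra_simps)
    show ?thesis
      by (subst eq, subst inner_add_right) (simp add: wT[OF k'] wu)
  qed
  with win show ?case by (auto simp: orthogonal_def)
qed

lemma orth_proj_span:
  fixes T :: "'a::real_inner set"
  assumes "finite T"
  shows "orth_proj (span T) x \<in> span T"
    and "y \<in> span T \<Longrightarrow> orthogonal (x - orth_proj (span T) x) y"
proof -
  obtain p where p: "p \<in> span T" "\<And>y. y \<in> span T \<Longrightarrow> orthogonal (x - p) y"
    using orth_decomp_exists_span[OF assms, of x] by blast
  have eq: "orth_proj (span T) x = p"
    by (rule orth_proj_eqI[OF subspace_span p])
  show "orth_proj (span T) x \<in> span T" unfolding eq by (rule p)
  show "y \<in> span T \<Longrightarrow> orthogonal (x - orth_proj (span T) x) y" unfolding eq by (rule p)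
qed

text \<open>
  The selected dictionary elements are \<open>g 1, g 2, \<dots>\<close>; the value \<open>g 0\<close> is irrelevant.
  For \<open>k = 0\<close> the span is trivial and the iterate is 0.
\<close>

definition oga_iterate :: "'a::real_inner \<Rightarrow> (nat \<Rightarrow> 'a) \<Rightarrow> nat \<Rightarrow> 'a" where
  "oga_iterate f g k = orth_proj (span (g ` {1..k})) f"

definition oga_residual :: "'a::real_inner \<Rightarrow> (nat \<Rightarrow> 'a) \<Rightarrow> nat \<Rightarrow> 'a" where
  "oga_residual f g k = f - oga_iterate f g k"

text \<open>
  \<open>oga_run D f n g\<close>: the elements \<open>g 1, \<dots>, g n\<close> are an admissible selection for the first \<open>n\<close>
  steps of the algorithm applied to \<open>f\<close>; nothing is required of the other values of \<open>g\<close>.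
\<close>

definition oga_run :: "'a::real_inner set \<Rightarrow> 'a \<Rightarrow> nat \<Rightarrow> (nat \<Rightarrow> 'a) \<Rightarrow> bool" where
  "oga_run D f n g \<longleftrightarrow>
     (\<forall>k\<in>{1..n}. is_arg_max (\<lambda>h. \<bar>inner h (oga_residual f g (k - 1))\<bar>) (\<lambda>h. h \<in> D) (g k))"

lemma oga_iterate_0: "oga_iterate f g 0 = 0"
  unfolding oga_iterate_def by (rule orth_proj_eqI) (auto simp: orthogonal_def)

end

theory Submission
  imports Defs "HOL-Real_Asymp.Real_Asymp"
begin

text \<open>
  The dictionary consists of the orthogonal vectors \<open>k\<^sup>-\<^sup>\<alpha> e\<^sub>k\<close> for \<open>k \<ge> 1\<close>, in the whole space.

  The lower bound is a bound for any approximation by \<open>n\<close> dictionary elements, whatever rule selects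
  them. The average of the first \<open>2n\<close> elements lies in the hull, an approximation that uses only \<open>n\<close>
  of them leaves at least \<open>n\<close> of its coordinates untouched, and each of these is at least
  \<open>(2n)\<^sup>-\<^sup>1\<^sup>-\<^sup>\<alpha>\<close>. The norm of the error is therefore at least
  \<open>n\<^sup>1\<^sup>/\<^sup>2 (2n)\<^sup>-\<^sup>1\<^sup>-\<^sup>\<alpha>\<close> (\<open>n_term_approximation_lower_bound\<close>). The maxima of the greedy algorithm are
  attained because the inner products of a fixed vector with the dictionary tend to zero.

  For the entropy, an element \<open>x\<close> of the hull before closure satisfies
  \<open>\<Sum>\<^sub>k k\<^sup>\<alpha> |x\<^sub>k| \<le> 1\<close>. Fix a real scale \<open>s > 0\<close> and round every coordinate toward zero
  to a multiple \<open>\<delta>\<^sub>k q\<^sub>k\<close> of the step \<open>\<delta>\<^sub>k = k\<^sup>\<alpha> s\<^sup>-\<^sup>1\<^sup>-\<^sup>2\<^sup>\<alpha>\<close>. The rounding error is bounded both by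
  the step and by the coordinate, so its square is at most \<open>\<delta>\<^sub>k |x\<^sub>k|\<close>, and these products add up to at
  most \<open>s\<^sup>-\<^sup>1\<^sup>-\<^sup>2\<^sup>\<alpha>\<close>: the steps grow at the rate at which one estimate covers the low and
  the high frequencies alike (\<open>quantize\<close>).

  The integer codes satisfy \<open>\<Sum>\<^sub>k w\<^sub>k |q\<^sub>k| \<le> s\<close> with \<open>w\<^sub>k = (k/s)\<^sup>2\<^sup>\<alpha>\<close>. An exponential
  moment bounds their number by \<open>exp s\<close> times the product of the factors
  \<open>1 + 2 / (exp w\<^sub>k - 1)\<close> (\<open>card_weighted_cross_polytope\<close>). The logarithms of the factors are the values
  of a fixed integrable function at the points \<open>k/s\<close>, hence add up to \<open>O(s)\<close>; here integrability
  is replaced by the explicit majorant \<open>min (sqrt (s/k)) ((s/k)\<^sup>2)\<close>. So there are \<open>exp (O(s))\<close>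
  codes, and taking \<open>s\<close> to be a small constant times \<open>n\<close> makes this at most \<open>2\<^sup>n\<close>.
\<close>

section \<open>Coordinates and the weighted orthogonal dictionary\<close>

lemma coord_Abs_ell2:
  assumes "\<And>i. i \<ge> N \<Longrightarrow> x i = 0"
  shows "coord (Abs_ell2 x) i = x i"
proof -
  have "summable (\<lambda>i. (x i)\<^sup>2)"
    by (rule summable_finite[of "{..<N}"]) (auto simp: assms not_less)
  then show ?thesis by (simp add: Abs_ell2_inverse)
qed

lemma coord_0: "coord 0 i = 0"
  by transfer simp

lemma coord_add: "coord (x + y) i = coord x i + coord y i"
  by transfer simp

lemma coord_scaleR: "coord (c *\<^sub>R x) i = c * coord x i"
  by transfer simp

lemma coord_sum: "coord (\<Sum>j\<in>A. F j) i = (\<Sum>j\<in>A. coord (F j) i)"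
  by (induction A rule: infinite_finite_induct) (simp_all add: coord_0 coord_add)

definition basis_vec :: "nat \<Rightarrow> ell2" where
  "basis_vec i = Abs_ell2 (\<lambda>j. if j = i then 1 else 0)"

lemma coord_basis_vec: "coord (basis_vec i) j = (if j = i then 1 else 0)"
  unfolding basis_vec_def by (rule coord_Abs_ell2[of "Suc i"]) auto

lemma inner_basis_vec: "inner (basis_vec i) x = coord x i"
proof -
  have "inner (basis_vec i) x = (\<Sum>j. coord (basis_vec i) j * coord x j)"
    by (rule inner_ell2.rep_eq)
  also have "\<dots> = (\<Sum>j\<in>{i}. coord (basis_vec i) j * coord x j)"
    by (rule suminf_finite) (auto simp: coord_basis_vec)
  finally show ?thesis by (simp add: coord_basis_vec)
qed

lemma norm_basis_vec: "norm (basis_vec i) = 1"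
  by (simp add: norm_eq_sqrt_inner inner_basis_vec coord_basis_vec)

definition atom :: "real \<Rightarrow> nat \<Rightarrow> ell2" where
  "atom \<alpha> i = real (Suc i) powr (- \<alpha>) *\<^sub>R basis_vec i"

lemma coord_atom: "coord (atom \<alpha> i) j = (if j = i then real (Suc i) powr (- \<alpha>) else 0)"
  by (simp add: atom_def coord_scaleR coord_basis_vec)

lemma norm_atom_le:
  assumes "\<alpha> > 0"
  shows "norm (atom \<alpha> i) \<le> 1"
proof -
  have "real (Suc i) powr (- \<alpha>) \<le> real (Suc i) powr 0"
    using assms by (intro powr_mono) auto
  then show ?thesis by (simp add: atom_def norm_basis_vec)
qed

text \<open>
  The weighted \<open>\<ell>\<^sup>1\<close> norm is a seminorm of value at most 1 on every dictionary element, so it is at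
  most 1 on combinations whose coefficients have absolute sum at most 1.
\<close>

lemma weighted_l1_hull:
  assumes "\<forall>j\<in>{1..n}. h j \<in> range (atom \<alpha>)" "(\<Sum>j=1..n. \<bar>a j\<bar>) \<le> 1"
  shows "(\<Sum>i<N. real (Suc i) powr \<alpha> * \<bar>coord (\<Sum>j=1..n. a j *\<^sub>R h j) i\<bar>) \<le> 1"
proof -
  have atom_le: "(\<Sum>i<N. real (Suc i) powr \<alpha> * \<bar>coord (h j) i\<bar>) \<le> 1" if "j \<in> {1..n}" for j
  proof -
    obtain m where m: "h j = atom \<alpha> m" using assms(1) \<open>j \<in> {1..n}\<close> by blast
    have "(\<Sum>i<N. real (Suc i) powr \<alpha> * \<bar>coord (h j) i\<bar>) = (\<Sum>i<N. if i = m then 1 else 0)"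
      unfolding m coord_atom by (intro sum.cong refl) (auto simp flip: powr_add)
    also have "\<dots> \<le> 1" by simp
    finally show ?thesis .
  qed
  have "(\<Sum>i<N. real (Suc i) powr \<alpha> * \<bar>coord (\<Sum>j=1..n. a j *\<^sub>R h j) i\<bar>)
      \<le> (\<Sum>i<N. \<Sum>j=1..n. \<bar>a j\<bar> * (real (Suc i) powr \<alpha> * \<bar>coord (h j) i\<bar>))"
  proof (rule sum_mono)
    fix i
    have "\<bar>coord (\<Sum>j=1..n. a j *\<^sub>R h j) i\<bar> \<le> (\<Sum>j=1..n. \<bar>a j\<bar> * \<bar>coord (h j) i\<bar>)"
      unfolding coord_sum coord_scaleR by (rule order.trans[OF sum_abs]) (simp add: abs_mult)
    then have "real (Suc i) powr \<alpha> * \<bar>coord (\<Sum>j=1..n. a j *\<^sub>R h j) i\<bar>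
        \<le> real (Suc i) powr \<alpha> * (\<Sum>j=1..n. \<bar>a j\<bar> * \<bar>coord (h j) i\<bar>)"
      by (intro mult_left_mono) auto
    then show "real (Suc i) powr \<alpha> * \<bar>coord (\<Sum>j=1..n. a j *\<^sub>R h j) i\<bar>
        \<le> (\<Sum>j=1..n. \<bar>a j\<bar> * (real (Suc i) powr \<alpha> * \<bar>coord (h j) i\<bar>))"
      by (simp add: sum_distrib_left mult_ac)
  qed
  also have "\<dots> = (\<Sum>j=1..n. \<bar>a j\<bar> * (\<Sum>i<N. real (Suc i) powr \<alpha> * \<bar>coord (h j) i\<bar>))"
    by (subst sum.swap) (simp add: sum_distrib_left)
  also have "\<dots> \<le> (\<Sum>j=1..n. \<bar>a j\<bar> * 1)"
    by (intro sum_mono mult_left_mono atom_le) auto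
  finally show ?thesis using assms(2) by simp
qed

section \<open>Counting integer vectors in a weighted cross-polytope\<close>

lemma sum_exp_abs_int_le:
  fixes w :: real and M :: int
  assumes "w > 0"
  shows "(\<Sum>m\<in>{-M..M}. exp (- w * \<bar>m\<bar>)) \<le> 1 + 2 / (exp w - 1)"
proof (cases "M \<ge> 0")
  case True
  define r where "r = exp (- w)"
  have r: "0 < r" "r < 1" using assms by (auto simp: r_def)
  have pw: "exp (- w * real k) = r ^ k" for k
    by (simp add: r_def exp_of_nat_mult[symmetric] mult.commute)
  have closed_form: "(\<Sum>m\<in>{-int K..int K}. exp (- w * \<bar>m\<bar>)) = (1 + r - 2 * r ^ Suc K) / (1 - r)" for K
  proof (induction K)
    case 0
    then show ?case using r by simp
  next
    case (Suc K)
    have "{- int (Suc K)..int (Suc K)}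
        = insert (int (Suc K)) (insert (- int (Suc K)) {- int K..int K})" by auto
    then have "(\<Sum>m\<in>{-int (Suc K)..int (Suc K)}. exp (- w * \<bar>m\<bar>))
        = 2 * exp (- w * real (Suc K)) + (\<Sum>m\<in>{-int K..int K}. exp (- w * \<bar>m\<bar>))"
      by simp
    also have "\<dots> = (1 + r - 2 * r ^ Suc (Suc K)) / (1 - r)"
      unfolding Suc pw using r by (simp add: field_simps)
    finally show ?case .
  qed
  have "M = int (nat M)" using True by simp
  then have "(\<Sum>m\<in>{-M..M}. exp (- w * \<bar>m\<bar>)) = (1 + r - 2 * r ^ Suc (nat M)) / (1 - r)"
    using closed_form[of "nat M"] by simp
  also have "\<dots> \<le> (1 + r) / (1 - r)"
    using r by (intro divide_right_mono) auto
  also have "\<dots> = 1 + 2 / (1 / r - 1)"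
    using r by (simp add: field_simps)
  finally show ?thesis by (simp add: r_def exp_minus field_simps)
next
  case False
  then show ?thesis using assms by simp
qed

text \<open>
  A Chernoff-type count: every admissible \<open>q\<close> has \<open>exp (W - \<Sum>\<^sub>i w\<^sub>i |q\<^sub>i|) \<ge> 1\<close>, and the sum of
  these quantities over a box that contains all admissible \<open>q\<close> factorizes into two-sided
  geometric series.
\<close>

lemma card_weighted_cross_polytope:
  fixes w :: "nat \<Rightarrow> real" and W :: real
  assumes w: "\<And>i. i < N \<Longrightarrow> w i > 0"
  defines "Q \<equiv> {q \<in> extensional {..<N}. (\<Sum>i<N. w i * \<bar>real_of_int (q i)\<bar>) \<le> W}"
  shows "finite Q"
    and "real (card Q) \<le> exp W * (\<Prod>i<N. 1 + 2 / (exp (w i) - 1))"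
proof -
  define S where "S i = {- \<lceil>W / w i\<rceil>..\<lceil>W / w i\<rceil>}" for i
  have sub: "Q \<subseteq> PiE {..<N} S"
  proof
    fix q assume q: "q \<in> Q"
    have "q i \<in> S i" if "i < N" for i
    proof -
      have "w i * \<bar>real_of_int (q i)\<bar> \<le> (\<Sum>i<N. w i * \<bar>real_of_int (q i)\<bar>)"
        using that w by (intro member_le_sum) (auto simp: less_imp_le)
      also have "\<dots> \<le> W" using q by (simp add: Q_def)
      finally have "\<bar>real_of_int (q i)\<bar> \<le> W / w i"
        using w[OF that] by (simp add: field_simps)
      then have "real_of_int \<bar>q i\<bar> \<le> real_of_int \<lceil>W / w i\<rceil>" by linarith
      then have "\<bar>q i\<bar> \<le> \<lceil>W / w i\<rceil>" by linarith
      then show ?thesis by (simp add: S_def abs_le_iff)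
    qed
    then show "q \<in> PiE {..<N} S" using q by (auto simp: Q_def PiE_def)
  qed
  have fin: "finite (PiE {..<N} S)" by (intro finite_PiE) (auto simp: S_def)
  show "finite Q" using sub fin by (rule finite_subset)
  have "real (card Q) = (\<Sum>q\<in>Q. 1)" by simp
  also have "\<dots> \<le> (\<Sum>q\<in>Q. exp (W - (\<Sum>i<N. w i * \<bar>real_of_int (q i)\<bar>)))"
    by (intro sum_mono) (simp add: Q_def)
  also have "\<dots> \<le> (\<Sum>q\<in>PiE {..<N} S. exp (W - (\<Sum>i<N. w i * \<bar>real_of_int (q i)\<bar>)))"
    using sub fin by (intro sum_mono2) auto
  also have "\<dots> = (\<Sum>q\<in>PiE {..<N} S. exp W * (\<Prod>i<N. exp (- w i * \<bar>real_of_int (q i)\<bar>)))"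
    by (simp add: exp_diff exp_minus prod_inversef[symmetric] exp_sum divide_inverse)
  also have "\<dots> = exp W * (\<Prod>i<N. \<Sum>m\<in>S i. exp (- w i * \<bar>m\<bar>))"
    by (subst prod_sum_PiE) (auto simp: S_def sum_distrib_left)
  also have "\<dots> \<le> exp W * (\<Prod>i<N. 1 + 2 / (exp (w i) - 1))"
    unfolding S_def using w
    by (intro mult_left_mono prod_mono conjI sum_exp_abs_int_le sum_nonneg) auto
  finally show "real (card Q) \<le> exp W * (\<Prod>i<N. 1 + 2 / (exp (w i) - 1))" .
qed

section \<open>The number of codes is exponential in the scale\<close>

lemma one_plus_power_div_fact_le_exp:
  fixes w :: real
  assumes "w \<ge> 0" "m > 0"
  shows "1 + w ^ m / fact m \<le> exp w"
proof -
  have "(\<Sum>k\<in>{0, m}. w ^ k /\<^sub>R fact k) \<le> (\<Sum>k. w ^ k /\<^sub>R fact k)"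
    using assms by (intro sum_le_suminf summable_exp_generic) auto
  then show ?thesis using assms by (simp add: exp_def field_simps)
qed

text \<open>
  Here \<open>u\<close> stands for \<open>s/k\<close>. For large \<open>u\<close> the factor is of order \<open>u\<^sup>2\<^sup>\<alpha>\<close>, whose logarithm is
  dominated by \<open>sqrt u\<close>; for small \<open>u\<close> the factor exceeds 1 by a quantity that decays faster than any
  power of \<open>u\<close>. Any exponents below and above 1 would serve in place of \<open>1/2\<close> and \<open>2\<close>: what
  matters is that the minimum is summable with total \<open>O(s)\<close>.
\<close>

lemma count_factor_le_exp_min:
  fixes \<alpha> :: real
  assumes "\<alpha> > 0"
  obtains A where "A > 0"
    "\<And>u. u > 0 \<Longrightarrow> 1 + 2 / (exp (u powr (- 2 * \<alpha>)) - 1) \<le> exp (A * min (sqrt u) (u\<^sup>2))"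
proof -
  \<comment> \<open>For \<open>u \<le> 1\<close> the \<open>m\<close>-th Taylor term of the exponential is used, with \<open>m\<close> so large that
    the exponent \<open>2 \<alpha> m\<close> of \<open>1/u\<close> in it is at least 2.\<close>
  define m where "m = nat \<lceil>1 / \<alpha>\<rceil>"
  have m: "m > 0" "\<alpha> * real m \<ge> 1"
  proof -
    show "m > 0" using assms by (simp add: m_def)
    have "1 / \<alpha> \<le> real m" unfolding m_def by linarith
    then show "\<alpha> * real m \<ge> 1" using assms by (simp add: field_simps)
  qed
  define A where "A = (2 + 4 * \<alpha>) + 2 * fact m"
  have "A > 0" using assms by (simp add: A_def add_pos_pos)
  moreover have "1 + 2 / (exp (u powr (- 2 * \<alpha>)) - 1) \<le> exp (A * min (sqrt u) (u\<^sup>2))" if u: "u > 0" for u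
  proof -
    define w where "w = u powr (- 2 * \<alpha>)"
    have w: "w > 0" using u by (simp add: w_def)
    show ?thesis
    proof (cases "u \<ge> 1")
      case True
      have "sqrt u \<le> u\<^sup>2"
        using power_increasing[of 1 4 u] True
        by (intro real_le_lsqrt) (auto simp: power_mult[symmetric, of u 2 2, simplified])
      then have mn: "min (sqrt u) (u\<^sup>2) = sqrt u" by simp
      have s1: "sqrt u \<ge> 1" using True by simp
      have "ln u = 2 * ln (sqrt u)" using u by (simp add: ln_sqrt)
      then have lnu: "ln u \<le> 2 * sqrt u" using ln_le_minus_one[of "sqrt u"] u by simp
      have "2 / (exp w - 1) \<le> 2 / w"
        using w exp_ge_add_one_self[of w] by (intro divide_left_mono mult_pos_pos) linarith+
      also have "2 / w = 2 * u powr (2 * \<alpha>)" by (simp add: w_def powr_minus field_simps)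
      finally have "1 + 2 / (exp w - 1) \<le> 1 + 2 * u powr (2 * \<alpha>)" by simp
      also have "\<dots> \<le> 3 * u powr (2 * \<alpha>)"
        using ge_one_powr_ge_zero[of u "2 * \<alpha>"] True assms by simp
      also have "\<dots> \<le> exp 2 * exp (2 * \<alpha> * ln u)"
        using exp_ge_add_one_self[of 2] u by (intro mult_mono) (auto simp: powr_def)
      also have "\<dots> = exp (2 + 2 * \<alpha> * ln u)" by (simp add: exp_add)
      also have "\<dots> \<le> exp (A * sqrt u)"
      proof -
        have "2 * \<alpha> * ln u \<le> 2 * \<alpha> * (2 * sqrt u)"
          using lnu assms by (intro mult_left_mono) auto
        moreover have "0 \<le> 2 * fact m * sqrt u" using u by simp
        ultimately have "2 + 2 * \<alpha> * ln u \<le> A * sqrt u"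
          using s1 unfolding A_def distrib_right by linarith
        then show ?thesis by simp
      qed
      finally show ?thesis by (simp add: mn w_def)
    next
      case False
      have u1: "u < 1" using False by simp
      have "u\<^sup>2 \<le> sqrt u"
        using power_decreasing[of 1 4 u] u u1
        by (intro real_le_rsqrt) (auto simp: power_mult[symmetric, of u 2 2, simplified])
      then have mn: "min (sqrt u) (u\<^sup>2) = u\<^sup>2" by simp
      have "w ^ m = u powr (- (2 * (\<alpha> * real m)))"
        using u by (simp add: w_def powr_powr mult_ac flip: powr_realpow)
      also have "\<dots> \<ge> u powr (- 2)"
        using u u1 m(2) by (intro powr_mono') auto
      also have "u powr (-2) = 1 / u\<^sup>2" using u by (simp add: powr_minus powr_numeral field_simps)
      finally have wm: "1 / u\<^sup>2 \<le> w ^ m" .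
      have "1 / u\<^sup>2 / fact m \<le> exp w - 1"
        using divide_right_mono[OF wm, of "fact m"]
          one_plus_power_div_fact_le_exp[OF less_imp_le[OF w] m(1)] by simp
      then have "2 / (exp w - 1) \<le> 2 / (1 / u\<^sup>2 / fact m)"
        using u w by (intro divide_left_mono mult_pos_pos) auto
      also have "\<dots> = 2 * fact m * u\<^sup>2" using u by simp
      also have "\<dots> \<le> A * u\<^sup>2"
        using assms by (intro mult_right_mono) (auto simp: A_def)
      finally show ?thesis
        using exp_ge_add_one_self[of "A * u\<^sup>2"] unfolding mn w_def by linarith
    qed
  qed
  ultimately show ?thesis by (rule that)
qed

text \<open>
  Compare with \<open>s\<close> times the integral of \<open>min (t\<^sup>-\<^sup>1\<^sup>/\<^sup>2) (t\<^sup>-\<^sup>2)\<close> over the positive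
  half-line. With \<open>k = i + 1\<close>, the terms with \<open>k \<le> s\<close> contribute at
  most \<open>2s\<close>, the first later term and the tail after it at most \<open>s\<close> each.
\<close>

lemma sum_min_sqrt_square_le:
  fixes s :: real
  assumes "s > 0"
  shows "(\<Sum>i<N. min (sqrt (s / real (Suc i))) ((s / real (Suc i))\<^sup>2)) \<le> 4 * s"
proof -
  define T where "T N = (\<Sum>i<N. min (sqrt (s / real (Suc i))) ((s / real (Suc i))\<^sup>2))" for N
  have step: "T (Suc N) \<le> T N + sqrt (s / real (Suc N))" "T (Suc N) \<le> T N + (s / real (Suc N))\<^sup>2" for N
    by (auto simp: T_def)
  \<comment> \<open>The induction carries antiderivatives, so that each step is a telescoping estimate.\<close>
  have "(real N \<le> s \<longrightarrow> T N \<le> 2 * sqrt (s * real N)) \<and> (s < real N \<longrightarrow> T N \<le> 4 * s - s\<^sup>2 / real N)"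
  proof (induction N)
    case 0
    then show ?case using assms by (simp add: T_def)
  next
    case (Suc N)
    define x where "x = real (Suc N)"
    have x: "x \<ge> 1" "real N = x - 1" by (auto simp: x_def)
    consider "x \<le> s" | "real N \<le> s" "s < x" | "s < real N" by linarith
    then show ?case
    proof cases
      case 1
      have a: "sqrt (s / x) = sqrt s / sqrt x" by (simp add: real_sqrt_divide)
      have "sqrt (x - 1) * sqrt x \<le> x - 1 / 2"
      proof -
        have "sqrt ((x - 1) * x) \<le> x - 1 / 2"
          by (rule real_le_lsqrt) (use x in \<open>auto simp: power2_eq_square algebra_simps\<close>)
        then show ?thesis by (simp add: real_sqrt_mult)
      qed
      then have "(2 * sqrt (x - 1) + 1 / sqrt x) * sqrt x \<le> (2 * sqrt x) * sqrt x"
        using x by (simp add: distrib_right mult.assoc)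
      then have "2 * sqrt (x - 1) + 1 / sqrt x \<le> 2 * sqrt x"
        by (rule mult_right_le_imp_le) (use x in simp)
      then have "sqrt s * (2 * sqrt (x - 1) + 1 / sqrt x) \<le> sqrt s * (2 * sqrt x)"
        using assms by (intro mult_left_mono) auto
      then have "2 * sqrt (s * (x - 1)) + sqrt (s / x) \<le> 2 * sqrt (s * x)"
        unfolding a real_sqrt_mult by (simp add: distrib_left mult_ac)
      then show ?thesis using Suc.IH 1 step(1)[of N] x unfolding x_def[symmetric] by auto
    next
      case 2
      have "sqrt (s * real N) \<le> s"
        by (rule real_le_lsqrt) (use 2 assms in \<open>auto simp: power2_eq_square\<close>)
      then have T: "T N \<le> 2 * s" using Suc.IH 2 by auto
      have "s\<^sup>2 / x \<le> s" using 2 assms x by (simp add: field_simps power2_eq_square)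
      moreover have "(s / x)\<^sup>2 \<le> s\<^sup>2 / x"
        unfolding power_divide using x by (intro divide_left_mono self_le_power) auto
      ultimately have "T (Suc N) \<le> 4 * s - s\<^sup>2 / x"
        using T step(2)[of N] unfolding x_def[symmetric] by linarith
      then show ?thesis using 2 unfolding x_def[symmetric] by auto
    next
      case 3
      have x1: "x > 1" using 3 assms x by linarith
      have "1 / x\<^sup>2 \<le> 1 / (x - 1) - 1 / x"
        using x1 by (simp add: field_simps power2_eq_square)
      then have "s\<^sup>2 * (1 / x\<^sup>2) \<le> s\<^sup>2 * (1 / (x - 1) - 1 / x)" by (intro mult_left_mono) auto
      then have "(s / x)\<^sup>2 \<le> s\<^sup>2 / (x - 1) - s\<^sup>2 / x" by (simp add: power_divide algebra_simps)
      then have "T (Suc N) \<le> 4 * s - s\<^sup>2 / x"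
        using Suc.IH 3 step(2)[of N] x unfolding x_def[symmetric] by auto
      then show ?thesis using 3 x unfolding x_def[symmetric] by auto
    qed
  qed
  moreover have "2 * sqrt (s * real N) \<le> 4 * s" if "real N \<le> s"
  proof -
    have "sqrt (s * real N) \<le> s"
      by (rule real_le_lsqrt) (use that assms in \<open>auto simp: power2_eq_square\<close>)
    then show ?thesis using assms by simp
  qed
  moreover have "s\<^sup>2 / real N \<ge> 0" by simp
  ultimately have "T N \<le> 4 * s" by linarith
  then show ?thesis by (simp add: T_def)
qed

section \<open>Metric entropy of the hull\<close>

lemma round_toward_zero:
  fixes x \<delta> :: real
  assumes "\<delta> > 0"
  obtains q :: int where "\<delta> * \<bar>real_of_int q\<bar> \<le> \<bar>x\<bar>" "(x - \<delta> * q)\<^sup>2 \<le> \<delta> * \<bar>x\<bar>"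
proof -
  define y where "y = \<bar>x\<bar> / \<delta>"
  define p where "p = \<lfloor>y\<rfloor>"
  have y: "y \<ge> 0" "\<bar>x\<bar> = \<delta> * y" using assms by (auto simp: y_def)
  have p: "0 \<le> p" "real_of_int p \<le> y" "y - p \<le> 1" using y by (auto simp: p_def) linarith+
  define \<sigma> :: int where "\<sigma> = (if x \<ge> 0 then 1 else - 1)"
  have "\<delta> * \<bar>real_of_int (\<sigma> * p)\<bar> \<le> \<bar>x\<bar>"
    using p assms y(2) by (simp add: abs_mult \<sigma>_def)
  moreover have "x - \<delta> * (\<sigma> * p) = \<sigma> * (\<bar>x\<bar> - \<delta> * p)" by (simp add: \<sigma>_def algebra_simps)
  then have "(x - \<delta> * (\<sigma> * p))\<^sup>2 = (\<bar>x\<bar> - \<delta> * p)\<^sup>2"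
    by (simp add: power_mult_distrib \<sigma>_def)
  moreover have "(\<bar>x\<bar> - \<delta> * p)\<^sup>2 \<le> \<delta> * \<bar>x\<bar>"
  proof -
    have "(y - p) * (y - p) \<le> 1 * y" using p by (intro mult_mono) auto
    then have "\<delta>\<^sup>2 * (y - p)\<^sup>2 \<le> \<delta>\<^sup>2 * y"
      by (intro mult_left_mono) (auto simp: power2_eq_square)
    then show ?thesis unfolding y(2) by (simp add: power2_eq_square algebra_simps)
  qed
  ultimately show ?thesis using that[of "\<sigma> * p"] by auto
qed

text \<open>
  The step \<open>\<delta>\<close> is matched to the weighted norm in two ways: \<open>\<Sum>\<^sub>i \<delta>\<^sub>i |f\<^sub>i|\<close>, which bounds the squared
  error, is \<open>s\<^sup>-\<^sup>1\<^sup>-\<^sup>2\<^sup>\<alpha>\<close> times that norm, and the code satisfies a constraint with total \<open>s\<close>, because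
  \<open>s (i+1)\<^sup>\<alpha> \<delta>\<^sub>i = ((i+1)/s)\<^sup>2\<^sup>\<alpha>\<close>. The coordinates from \<open>N\<close> on are all rounded to zero, since a single
  unit there would exceed the total.
\<close>

lemma quantize:
  fixes \<alpha> s :: real
  assumes s: "s > 0" and \<alpha>: "\<alpha> > 0"
    and f: "\<And>N. (\<Sum>i<N. real (Suc i) powr \<alpha> * \<bar>coord f i\<bar>) \<le> 1"
    and N: "\<And>i. i \<ge> N \<Longrightarrow> s < (real (Suc i) / s) powr (2 * \<alpha>)"
  defines "\<delta> \<equiv> \<lambda>i. real (Suc i) powr \<alpha> * s powr (- 1 - 2 * \<alpha>)"
  obtains q where "q \<in> extensional {..<N}"
    "(\<Sum>i<N. (real (Suc i) / s) powr (2 * \<alpha>) * \<bar>real_of_int (q i)\<bar>) \<le> s"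
    "norm (f - Abs_ell2 (\<lambda>i. if i < N then \<delta> i * real_of_int (q i) else 0)) \<le> s powr (- 1/2 - \<alpha>)"
proof -
  have \<delta>: "\<delta> i > 0" for i using s by (simp add: \<delta>_def)
  have "\<exists>q::int. \<delta> i * \<bar>real_of_int q\<bar> \<le> \<bar>coord f i\<bar> \<and> (coord f i - \<delta> i * q)\<^sup>2 \<le> \<delta> i * \<bar>coord f i\<bar>"
    for i
    by (rule round_toward_zero[OF \<delta>[of i], of "coord f i"]) blast
  then obtain p :: "nat \<Rightarrow> int" where p: "\<And>i. \<delta> i * \<bar>real_of_int (p i)\<bar> \<le> \<bar>coord f i\<bar>"
      "\<And>i. (coord f i - \<delta> i * p i)\<^sup>2 \<le> \<delta> i * \<bar>coord f i\<bar>" by metis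
  have weight: "(real (Suc i) / s) powr (2 * \<alpha>) * \<bar>real_of_int (p i)\<bar>
      \<le> s * (real (Suc i) powr \<alpha> * \<bar>coord f i\<bar>)" for i
  proof -
    have "(real (Suc i) / s) powr (2 * \<alpha>) = s * real (Suc i) powr \<alpha> * \<delta> i"
    proof -
      have "s * s powr (- 1 - 2 * \<alpha>) = s powr (- 2 * \<alpha>)"
        using s by (simp add: powr_diff powr_minus field_simps)
      moreover have "real (Suc i) powr \<alpha> * real (Suc i) powr \<alpha> = real (Suc i) powr (2 * \<alpha>)"
        by (simp flip: powr_add)
      moreover have "(real (Suc i) / s) powr (2 * \<alpha>) = real (Suc i) powr (2 * \<alpha>) * s powr (- 2 * \<alpha>)"
        using s by (simp add: powr_divide powr_minus field_simps)
      ultimately show ?thesis unfolding \<delta>_def by (metis mult.assoc mult.left_commute)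
    qed
    then have "(real (Suc i) / s) powr (2 * \<alpha>) * \<bar>real_of_int (p i)\<bar>
        = s * real (Suc i) powr \<alpha> * (\<delta> i * \<bar>real_of_int (p i)\<bar>)" by simp
    also have "\<dots> \<le> s * real (Suc i) powr \<alpha> * \<bar>coord f i\<bar>"
      using p(1) s by (intro mult_left_mono) auto
    finally show ?thesis by (simp add: mult.assoc)
  qed
  have total: "(\<Sum>i<M. (real (Suc i) / s) powr (2 * \<alpha>) * \<bar>real_of_int (p i)\<bar>) \<le> s" for M
  proof -
    have "(\<Sum>i<M. (real (Suc i) / s) powr (2 * \<alpha>) * \<bar>real_of_int (p i)\<bar>)
        \<le> s * (\<Sum>i<M. real (Suc i) powr \<alpha> * \<bar>coord f i\<bar>)"
      unfolding sum_distrib_left by (intro sum_mono weight)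
    also have "\<dots> \<le> s * 1" using f s by (intro mult_left_mono) auto
    finally show ?thesis by simp
  qed
  have p0: "p i = 0" if "i \<ge> N" for i
  proof (rule ccontr)
    assume "p i \<noteq> 0"
    then have "1 \<le> \<bar>real_of_int (p i)\<bar>" by linarith
    then have "s < (real (Suc i) / s) powr (2 * \<alpha>) * \<bar>real_of_int (p i)\<bar>"
      using N[OF that] mult_left_mono[of 1 "\<bar>real_of_int (p i)\<bar>" "(real (Suc i) / s) powr (2 * \<alpha>)"]
      by simp
    also have "\<dots> \<le> (\<Sum>i<Suc i. (real (Suc i) / s) powr (2 * \<alpha>) * \<bar>real_of_int (p i)\<bar>)"
      by (intro member_le_sum) auto
    also have "\<dots> \<le> s" by (rule total)
    finally show False by simp
  qed
  define q where "q = restrict p {..<N}"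
  define c where "c = Abs_ell2 (\<lambda>i. if i < N then \<delta> i * real_of_int (q i) else 0)"
  have c: "coord c i = \<delta> i * p i" for i
    unfolding c_def by (subst coord_Abs_ell2[of N]) (auto simp: q_def p0)
  have "norm (f - c) \<le> s powr (- 1/2 - \<alpha>)"
  proof (rule power2_le_imp_le)
    have "(norm (f - c))\<^sup>2 = (\<Sum>i. (coord f i - \<delta> i * p i)\<^sup>2)"
      by (simp add: norm_ell2_sq coord_minus c)
    also have "\<dots> \<le> s powr (- 1 - 2 * \<alpha>)"
    proof (rule suminf_le_const)
      show "summable (\<lambda>i. (coord f i - \<delta> i * p i)\<^sup>2)"
        using summable_coord_sq[of "f - c"] by (simp add: coord_minus c)
      show "(\<Sum>i<M. (coord f i - \<delta> i * p i)\<^sup>2) \<le> s powr (- 1 - 2 * \<alpha>)" for M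
      proof -
        have "(\<Sum>i<M. (coord f i - \<delta> i * p i)\<^sup>2) \<le> (\<Sum>i<M. \<delta> i * \<bar>coord f i\<bar>)"
          by (intro sum_mono p(2))
        also have "\<dots> = s powr (- 1 - 2 * \<alpha>) * (\<Sum>i<M. real (Suc i) powr \<alpha> * \<bar>coord f i\<bar>)"
          by (simp add: \<delta>_def sum_distrib_left mult_ac)
        also have "\<dots> \<le> s powr (- 1 - 2 * \<alpha>) * 1" by (intro mult_left_mono f) simp
        finally show ?thesis by simp
      qed
    qed
    also have "\<dots> = (s powr (- 1/2 - \<alpha>))\<^sup>2"
      by (simp add: power2_eq_square flip: powr_add)
    finally show "(norm (f - c))\<^sup>2 \<le> (s powr (- 1/2 - \<alpha>))\<^sup>2" .
  qed simp
  moreover have "(\<Sum>i<N. (real (Suc i) / s) powr (2 * \<alpha>) * \<bar>real_of_int (q i)\<bar>) \<le> s"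
    using total[of N] by (simp add: q_def)
  moreover have "q \<in> extensional {..<N}" by (simp add: q_def)
  ultimately show ?thesis using that[of q] by (simp add: c_def)
qed

lemma entropy_number_le:
  assumes "finite Q" "card Q \<le> 2 ^ n" "\<And>q. c q \<in> H" "A \<subseteq> (\<Union>q\<in>Q. cball (c q) e)" "e \<ge> 0"
  shows "entropy_number H n A \<le> ereal e"
proof -
  obtain h where h: "bij_betw h {0..<card Q} Q"
    using ex_bij_betw_nat_finite[OF assms(1)] by blast
  have "A \<subseteq> (\<Union>i < 2 ^ n. cball (c (h i)) e)"
  proof
    fix x assume "x \<in> A"
    then obtain q where q: "q \<in> Q" "x \<in> cball (c q) e" using assms(4) by blast
    moreover have "q \<in> h ` {0..<card Q}" using h q(1) by (simp add: bij_betw_def)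
    ultimately obtain i where "i < card Q" "h i = q" by auto
    then show "x \<in> (\<Union>i < 2 ^ n. cball (c (h i)) e)"
      using q assms(2) by (intro UN_I[of i]) auto
  qed
  then show ?thesis
    unfolding entropy_number_def using assms(3,5)
    by (intro Inf_lower CollectI exI[of _ e] conjI exI[of _ "\<lambda>i. c (h i)"]) auto
qed

lemma entropy_B1_atoms:
  fixes \<alpha> :: real
  assumes \<alpha>: "\<alpha> > 0"
  obtains C where
    "\<And>n. n \<ge> 1 \<Longrightarrow> entropy_number UNIV n (B1 (range (atom \<alpha>))) \<le> ereal (C * real n powr (- (1/2) - \<alpha>))"
proof -
  obtain A where A: "A > 0"
    "\<And>u. u > 0 \<Longrightarrow> 1 + 2 / (exp (u powr (- 2 * \<alpha>)) - 1) \<le> exp (A * min (sqrt u) (u\<^sup>2))"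
    using count_factor_le_exp_min[OF \<alpha>] by blast
  \<comment> \<open>With \<open>s = b n\<close> the bound \<open>exp ((1 + 4 A) s)\<close> on the number of codes is exactly \<open>2 ^ n\<close>.\<close>
  define b where "b = ln 2 / (1 + 4 * A)"
  have b: "b > 0" using A by (simp add: b_def)
  have "entropy_number UNIV n (B1 (range (atom \<alpha>))) \<le> ereal (b powr (- (1/2) - \<alpha>) * real n powr (- (1/2) - \<alpha>))"
    if n: "n \<ge> 1" for n
  proof -
    define s where "s = b * real n"
    have s: "s > 0" using b n by (simp add: s_def)
    define w where "w i = (real (Suc i) / s) powr (2 * \<alpha>)" for i
    have "filterlim (\<lambda>i. (real (Suc i) / s) powr (2 * \<alpha>)) at_top sequentially"
      using \<alpha> s by real_asymp
    then obtain N where N: "\<And>i. i \<ge> N \<Longrightarrow> s < w i"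
      unfolding w_def filterlim_at_top_dense eventually_sequentially by meson
    define Q where "Q = {q \<in> extensional {..<N}. (\<Sum>i<N. w i * \<bar>real_of_int (q i)\<bar>) \<le> s}"
    have w: "w i > 0" for i using s by (simp add: w_def)
    note count = card_weighted_cross_polytope[of N w s, OF w, folded Q_def]
    have "real (card Q) \<le> exp s * (\<Prod>i<N. 1 + 2 / (exp (w i) - 1))" by (rule count)
    also have "\<dots> \<le> exp s * (\<Prod>i<N. exp (A * min (sqrt (s / real (Suc i))) ((s / real (Suc i))\<^sup>2)))"
    proof (intro mult_left_mono prod_mono conjI)
      fix i
      show "0 \<le> 1 + 2 / (exp (w i) - 1)" using w[of i] by (simp add: add_nonneg_nonneg)
      have "w i = (s / real (Suc i)) powr (- 2 * \<alpha>)"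
        using s by (simp add: w_def powr_divide powr_minus field_simps)
      then show "1 + 2 / (exp (w i) - 1) \<le> exp (A * min (sqrt (s / real (Suc i))) ((s / real (Suc i))\<^sup>2))"
        using A(2)[of "s / real (Suc i)"] s by simp
    qed simp
    also have "\<dots> = exp (s + A * (\<Sum>i<N. min (sqrt (s / real (Suc i))) ((s / real (Suc i))\<^sup>2)))"
      by (simp add: exp_add exp_sum sum_distrib_left)
    also have "\<dots> \<le> exp (s + A * (4 * s))"
      using sum_min_sqrt_square_le[OF s, of N] A(1) by (simp add: mult_left_mono)
    also have "s + A * (4 * s) = real n * ln 2"
      proof -
      have "s * (1 + 4 * A) = real n * ln 2" using A(1) by (simp add: s_def b_def)
      then show ?thesis by (simp add: algebra_simps)
    qed
    also have "exp (real n * ln 2) = 2 ^ n" by (simp add: exp_of_nat_mult)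
    finally have card: "card Q \<le> 2 ^ n"
      by (metis of_nat_le_iff of_nat_numeral of_nat_power)
    define c where "c q = Abs_ell2 (\<lambda>i. if i < N
        then real (Suc i) powr \<alpha> * s powr (- 1 - 2 * \<alpha>) * real_of_int (q i) else 0)" for q
    \<comment> \<open>A finite union of closed balls is closed, so covering the combinations covers their closure.\<close>
    have "B1 (range (atom \<alpha>)) \<subseteq> (\<Union>q\<in>Q. cball (c q) (s powr (- 1/2 - \<alpha>)))"
      unfolding B1_def
    proof (rule closure_minimal)
      show "closed (\<Union>q\<in>Q. cball (c q) (s powr (- 1/2 - \<alpha>)))"
        using count(1) by (intro closed_UN) auto
      show "{\<Sum>j=1..n. a j *\<^sub>R h j | n a h. (\<forall>j\<in>{1..n}. h j \<in> range (atom \<alpha>)) \<and> (\<Sum>j=1..n. \<bar>a j\<bar>) \<le> 1}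
          \<subseteq> (\<Union>q\<in>Q. cball (c q) (s powr (- 1/2 - \<alpha>)))"
      proof clarify
        fix m a h
        assume h: "\<forall>j\<in>{1..m}. h j \<in> range (atom \<alpha>)" "(\<Sum>j=1..m. \<bar>a j\<bar>) \<le> (1::real)"
        define f where "f = (\<Sum>j=1..m. a j *\<^sub>R h j)"
        have "\<And>N. (\<Sum>i<N. real (Suc i) powr \<alpha> * \<bar>coord f i\<bar>) \<le> 1"
          unfolding f_def by (rule weighted_l1_hull[OF h])
        then obtain q where "q \<in> Q" "norm (f - c q) \<le> s powr (- 1/2 - \<alpha>)"
          using quantize[OF s \<alpha> _ N[unfolded w_def], of f]
          unfolding Q_def c_def w_def by blast
        then show "(\<Sum>j=1..m. a j *\<^sub>R h j) \<in> (\<Union>q\<in>Q. cball (c q) (s powr (- 1/2 - \<alpha>)))"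
          unfolding f_def by (auto simp: dist_norm norm_minus_commute)
      qed
    qed
    then have "entropy_number UNIV n (B1 (range (atom \<alpha>))) \<le> ereal (s powr (- 1/2 - \<alpha>))"
      using count(1) card by (intro entropy_number_le[of Q _ c]) auto
    also have "s powr (- 1/2 - \<alpha>) = b powr (- (1/2) - \<alpha>) * real n powr (- (1/2) - \<alpha>)"
      using b by (simp add: s_def powr_mult)
    finally show ?thesis .
  qed
  then show ?thesis using that by blast
qed

section \<open>The orthogonal greedy algorithm on the weighted dictionary\<close>

lemma arg_max_of_null_sequence:
  fixes x :: "nat \<Rightarrow> real"
  assumes "x \<longlonglongrightarrow> 0" "\<And>i. x i \<ge> 0"
  obtains i where "\<And>j. x j \<le> x i"
proof (cases "\<exists>i. x i > 0")
  case True
  then obtain i0 where i0: "x i0 > 0" by blast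
  obtain N where N: "\<And>j. j \<ge> N \<Longrightarrow> x j < x i0"
    using order_tendstoD(2)[OF assms(1) i0] unfolding eventually_sequentially by blast
  have i0N: "i0 < N" using N[of i0] by force
  have "Max (x ` {..<N}) \<in> x ` {..<N}" using i0N by (intro Max_in) auto
  then obtain i where i: "x i = Max (x ` {..<N})" by auto
  have "x j \<le> x i" for j
  proof (cases "j < N")
    case True
    then show ?thesis unfolding i by (intro Max_ge) auto
  next
    case False
    then have "x j < x i0" using N by simp
    also have "x i0 \<le> x i" unfolding i using i0N by (intro Max_ge) auto
    finally show ?thesis by simp
  qed
  then show ?thesis by (rule that)
next
  case False
  then show ?thesis using that[of 0] assms(2) by (meson not_less order.trans)
qed

lemma atom_arg_max_exists:
  assumes "\<alpha> > 0"
  shows "\<exists>h. is_arg_max (\<lambda>h. \<bar>inner h r\<bar>) (\<lambda>h. h \<in> range (atom \<alpha>)) h"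
proof -
  have inner_atom: "inner (atom \<alpha> i) r = real (Suc i) powr (- \<alpha>) * coord r i" for i
    by (simp add: atom_def inner_basis_vec)
  have "(\<lambda>i. sqrt ((coord r i)\<^sup>2)) \<longlonglongrightarrow> sqrt 0"
    by (intro tendsto_real_sqrt summable_LIMSEQ_zero summable_coord_sq)
  then have coord0: "(\<lambda>i. \<bar>coord r i\<bar>) \<longlonglongrightarrow> 0" by simp
  have "(\<lambda>i. \<bar>inner (atom \<alpha> i) r\<bar>) \<longlonglongrightarrow> 0"
  proof (rule tendsto_sandwich[OF _ _ tendsto_const coord0])
    have "\<bar>inner (atom \<alpha> i) r\<bar> \<le> \<bar>coord r i\<bar>" for i
    proof -
      have "real (Suc i) powr (- \<alpha>) \<le> 1"
        using norm_atom_le[OF assms, of i] by (simp add: atom_def norm_basis_vec)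
      then show ?thesis by (simp add: inner_atom abs_mult mult_left_le_one_le)
    qed
    then show "\<forall>\<^sub>F i in sequentially. \<bar>inner (atom \<alpha> i) r\<bar> \<le> \<bar>coord r i\<bar>" by simp
  qed simp
  then obtain i where "\<And>j. \<bar>inner (atom \<alpha> j) r\<bar> \<le> \<bar>inner (atom \<alpha> i) r\<bar>"
    using arg_max_of_null_sequence[of "\<lambda>i. \<bar>inner (atom \<alpha> i) r\<bar>"] by auto
  then show ?thesis by (intro exI[of _ "atom \<alpha> i"]) (auto simp: is_arg_max_def not_less)
qed

lemma oga_run_extend:
  assumes "oga_run D f n g"
    and "is_arg_max (\<lambda>h. \<bar>inner h (oga_residual f g n)\<bar>) (\<lambda>h. h \<in> D) h"
  shows "oga_run D f (Suc n) (g(Suc n := h))"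
  unfolding oga_run_def
proof
  fix k assume k: "k \<in> {1..Suc n}"
  have "g(Suc n := h) ` {1..k - 1} = g ` {1..k - 1}" using k by (intro image_cong) auto
  then have r: "oga_residual f (g(Suc n := h)) (k - 1) = oga_residual f g (k - 1)"
    by (simp only: oga_residual_def oga_iterate_def)
  show "is_arg_max (\<lambda>h'. \<bar>inner h' (oga_residual f (g(Suc n := h)) (k - 1))\<bar>) (\<lambda>h. h \<in> D)
      ((g(Suc n := h)) k)"
    unfolding r using k assms by (cases "k = Suc n") (auto simp: oga_run_def)
qed

text \<open>
  Each selected element occupies a single coordinate, so a combination of them occupies no more
  coordinates than there are selections.
\<close>

lemma span_atoms_support:
  assumes "g ` J \<subseteq> range (atom \<alpha>)" "finite J"
  obtains I where "finite I" "card I \<le> card J" "\<And>p i. p \<in> span (g ` J) \<Longrightarrow> i \<notin> I \<Longrightarrow> coord p i = 0"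
proof -
  have "\<forall>j\<in>J. \<exists>i. g j = atom \<alpha> i" using assms(1) by blast
  from bchoice[OF this] obtain \<iota> where \<iota>: "\<And>j. j \<in> J \<Longrightarrow> g j = atom \<alpha> (\<iota> j)"
    by blast
  have "coord p i = 0" if "p \<in> span (g ` J)" "i \<notin> \<iota> ` J" for p i
    using that(1)
  proof (induction rule: span_induct)
    case base
    show ?case by (auto simp: subspace_def coord_0 coord_add coord_scaleR)
  next
    case (step x)
    then show ?case using that(2) by (auto simp: \<iota> coord_atom)
  qed
  then show ?thesis using that[of "\<iota> ` J"] assms(2) by (auto simp: card_image_le)
qed

lemma flat_average_in_B1:
  assumes "n \<ge> 1"
  shows "(\<Sum>i<n. (1 / real n) *\<^sub>R h i) \<in> B1 (range h)"
proof -
  have "(\<Sum>i<n. (1 / real n) *\<^sub>R h i) = (\<Sum>j=1..n. (1 / real n) *\<^sub>R h (j - 1))"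
    by (rule sum.reindex_bij_witness[of _ "\<lambda>j. j - 1" Suc]) auto
  then show ?thesis
    unfolding B1_def using assms
    by (intro subsetD[OF closure_subset] CollectI exI[of _ n] exI[of _ "\<lambda>_. 1 / real n"]
        exI[of _ "\<lambda>j. h (j - 1)"]) auto
qed

text \<open>
  The elements are orthogonal, so each one of the average that is not used is a loss that the used
  ones cannot compensate, and at most half of them are used.
\<close>

lemma n_term_approximation_lower_bound:
  fixes \<alpha> :: real
  assumes \<alpha>: "\<alpha> > 0" and n: "n \<ge> 1" and g: "g ` {1..n} \<subseteq> range (atom \<alpha>)"
    and p: "p \<in> span (g ` {1..n})"
  shows "2 powr (- 1 - \<alpha>) * real n powr (- (1/2) - \<alpha>)
    \<le> norm ((\<Sum>i<2*n. (1 / real (2*n)) *\<^sub>R atom \<alpha> i) - p)"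
proof (rule power2_le_imp_le)
  define f where "f = (\<Sum>i<2*n. (1 / real (2*n)) *\<^sub>R atom \<alpha> i)"
  define t where "t = real (2*n) powr (- 1 - \<alpha>)"
  obtain I where I: "finite I" "card I \<le> card {1..n}"
      and supp: "\<And>p i. p \<in> span (g ` {1..n}) \<Longrightarrow> i \<notin> I \<Longrightarrow> coord p i = 0"
    by (rule span_atoms_support[OF g finite_atLeastAtMost]) blast
  have coord_f: "coord f i = (1 / real (2*n)) * real (Suc i) powr (- \<alpha>)" if "i < 2*n" for i
    unfolding f_def coord_sum coord_scaleR coord_atom using that by (simp add: if_distrib cong: if_cong)
  have f_ge: "t\<^sup>2 \<le> (coord (f - p) i)\<^sup>2" if i: "i \<in> {..<2*n} - I" for i
  proof (rule power_mono)
    have "t = (1 / real (2*n)) * real (2*n) powr (- \<alpha>)"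
      using n by (simp add: t_def powr_diff powr_minus field_simps)
    also have "\<dots> \<le> (1 / real (2*n)) * real (Suc i) powr (- \<alpha>)"
      using i \<alpha> by (intro mult_left_mono powr_mono2') auto
    also have "\<dots> = coord (f - p) i" using i supp[OF p] coord_f by (simp add: coord_minus)
    finally show "t \<le> coord (f - p) i" .
  qed (simp add: t_def)
  have "n \<le> card ({..<2*n} - I)"
    using diff_card_le_card_Diff[OF I(1), of "{..<2*n}"] I(2) by simp
  then have "real n * t\<^sup>2 \<le> real (card ({..<2*n} - I)) * t\<^sup>2" by (intro mult_right_mono) auto
  also have "\<dots> \<le> (\<Sum>i\<in>{..<2*n} - I. (coord (f - p) i)\<^sup>2)"
    using sum_mono[of "{..<2*n} - I" "\<lambda>_. t\<^sup>2", OF f_ge] by simp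
  also have "\<dots> \<le> (\<Sum>i<2*n. (coord (f - p) i)\<^sup>2)" by (intro sum_mono2) auto
  also have "\<dots> \<le> (norm (f - p))\<^sup>2" by (rule sum_coord_sq_le)
  finally have "real n * t\<^sup>2 \<le> (norm (f - p))\<^sup>2" .
  moreover have "real n * t\<^sup>2 = (2 powr (- 1 - \<alpha>) * real n powr (- (1/2) - \<alpha>))\<^sup>2"
  proof -
    have "real n * (real n powr (- 1 - \<alpha>))\<^sup>2 = real n powr 1 * (real n powr (- 1 - \<alpha>) * real n powr (- 1 - \<alpha>))"
      by (simp add: power2_eq_square)
    also have "\<dots> = real n powr (- (1/2) - \<alpha>) * real n powr (- (1/2) - \<alpha>)"
      unfolding powr_add[symmetric] by simp
    finally show ?thesis by (simp add: t_def powr_mult power_mult_distrib power2_eq_square)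
  qed
  ultimately show "(2 powr (- 1 - \<alpha>) * real n powr (- (1/2) - \<alpha>))\<^sup>2
      \<le> (norm ((\<Sum>i<2*n. (1 / real (2*n)) *\<^sub>R atom \<alpha> i) - p))\<^sup>2"
    unfolding f_def by simp
qed simp

theorem proposition2:
  fixes \<alpha> :: real
  assumes "\<alpha> > 0"
  shows "\<exists>(H :: ell2 set) (D :: ell2 set) (C :: real) (K :: real).
    subspace H \<and> closed H \<and> D \<subseteq> H \<and> (\<forall>g\<in>D. norm g \<le> 1) \<and> K > 0 \<and>
    (\<forall>n\<ge>1. entropy_number H n (B1 D) \<le> ereal (C * real n powr (- (1/2) - \<alpha>))) \<and>
    (\<forall>f\<in>H. \<forall>n g. oga_run D f n g \<longrightarrow> (\<exists>h. oga_run D f (Suc n) (g(Suc n := h)))) \<and>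
    (\<forall>n\<ge>1. \<forall>G. (\<forall>f\<in>B1 D. oga_run D f n (G f)) \<longrightarrow>
       (SUP f\<in>B1 D. ereal (norm (f - oga_iterate f (G f) n)))
         \<ge> ereal (K * real n powr (- (1/2) - \<alpha>)))"
proof -
  define D where "D = range (atom \<alpha>)"
  obtain C where C: "\<And>n. n \<ge> 1 \<Longrightarrow> entropy_number UNIV n (B1 D) \<le> ereal (C * real n powr (- (1/2) - \<alpha>))"
    using entropy_B1_atoms[OF assms] unfolding D_def by blast
  have extend: "\<exists>h. oga_run D f (Suc n) (g(Suc n := h))" if "oga_run D f n g" for f n g
    using oga_run_extend[OF that] atom_arg_max_exists[OF assms] unfolding D_def by blast
  have lower: "ereal (2 powr (- 1 - \<alpha>) * real n powr (- (1/2) - \<alpha>))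
      \<le> (SUP f\<in>B1 D. ereal (norm (f - oga_iterate f (G f) n)))"
    if n: "n \<ge> 1" and G: "\<forall>f\<in>B1 D. oga_run D f n (G f)" for n G
  proof -
    define f where "f = (\<Sum>i<2*n. (1 / real (2*n)) *\<^sub>R atom \<alpha> i)"
    have f: "f \<in> B1 D" unfolding f_def D_def using n by (intro flat_average_in_B1) simp
    have "G f ` {1..n} \<subseteq> range (atom \<alpha>)"
      using G f by (auto simp: oga_run_def is_arg_max_def D_def)
    moreover have "oga_iterate f (G f) n \<in> span (G f ` {1..n})"
      unfolding oga_iterate_def by (rule orth_proj_span) simp
    ultimately have "2 powr (- 1 - \<alpha>) * real n powr (- (1/2) - \<alpha>)
        \<le> norm (f - oga_iterate f (G f) n)"
      unfolding f_def by (intro n_term_approximation_lower_bound[OF assms n]) auto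
    then show ?thesis by (intro SUP_upper2[OF f]) simp
  qed
  show ?thesis
    using C extend lower norm_atom_le[OF assms]
    by (intro exI[of _ UNIV] exI[of _ D] exI[of _ C] exI[of _ "2 powr (- 1 - \<alpha>)"])
      (auto simp: D_def)
qed

end
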